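(* Let $m,n\geq 1$ be integers. For any $A\in M_{m,n}(\mathbb{R})$ and $\mathbf{b}\in\mathbb{R}^m$, the pair $(A,\mathbf{b})$ is infinitely badly approximable if and only if ${}^tA$ is singular for $\mathbf{b}$. In particular, for every $\mathbf{b}\in\mathbb{R}^m$, \[ \mathbf{Bad}^{\mathbf{b}}(\infty)=\mathbf{Sing}(\mathbf{b})\quad\text{and}\quad \mathbf{Bad}(\infty)=\bigcup_{\mathbf{b}\in\mathbb{R}^m}\mathbf{Sing}(\mathbf{b})\times\{\mathbf{b}\}. \]
   Context: For $\mathbf{x}\in\mathbb{R}^k$, $\|\mathbf{x}\|=\max_i|x_i|$ and $\|\mathbf{x}\|_{\mathbb{Z}}=\min_{\mathbf{n}\in\mathbb{Z}^k}\|\mathbf{x}-\mathbf{n}\|$; for $x\in\mathbb{R}$, $|x|_{\mathbb{Z}}$ is the distance from $x$ to the nearest integer; ${}^tA$ is the transpose and $\cdot$ the usual dot product. A pair $(A,\mathbf{b})\in M_{m,n}(\mathbb{R})\times\mathbb{R}^m$ is $\epsilon$-badly approximable ($\epsilon>0$) if $\liminf_{\mathbf{q}\in\mathbb{Z}^n,\|\mathbf{q}\|\to\infty}\|\mathbf{q}\|^{n/m}\|A\mathbf{q}-\mathbf{b}\|_{\mathbb{Z}}\geq\epsilon$; the set of such pairs is $\mathbf{Bad}(\epsilon)$, and $\mathbf{Bad}^{\mathbf{b}}(\epsilon)=\{A:(A,\mathbf{b})\in\mathbf{Bad}(\epsilon)\}$. The pair is infinitely badly approximable if it is $\epsilon$-badly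 approximable for all $\epsilon>0$, i.e. the liminf equals $\infty$; $\mathbf{Bad}(\infty)=\bigcap_{\epsilon>0}\mathbf{Bad}(\epsilon)$ and $\mathbf{Bad}^{\mathbf{b}}(\infty)=\bigcap_{\epsilon>0}\mathbf{Bad}^{\mathbf{b}}(\epsilon)$. For fixed $\mathbf{b}\in\mathbb{R}^m$, ${}^tA\in M_{n,m}(\mathbb{R})$ is singular for $\mathbf{b}$ if for every $\epsilon>0$ and all sufficiently large $X$ the inequalities $\|{}^tA\mathbf{y}\|_{\mathbb{Z}}<\epsilon|\mathbf{b}\cdot\mathbf{y}|_{\mathbb{Z}}X^{-m/n}$ and $\|\mathbf{y}\|<|\mathbf{b}\cdot\mathbf{y}|_{\mathbb{Z}}X$ have a solution $\mathbf{y}\in\mathbb{Z}^m$. $\mathbf{Sing}(\mathbf{b})$ is the set of $A\in M_{m,n}(\mathbb{R})$ such that ${}^tA$ is singular for $\mathbf{b}$. *)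

theory Defs
  imports "HOL-Analysis.Analysis"
begin

text \<open>
  A real \<open>m \<times> n\<close> matrix is an element of \<open>real^'n^'m\<close> with \<open>m = CARD('m)\<close> and \<open>n = CARD('n)\<close>;
  both are at least 1 because types are nonempty. On \<open>real^'k\<close>, the library's \<open>infnorm\<close> is the
  maximum norm.
\<close>

definition int_vecs :: "(real^'k) set" where
  "int_vecs = {x. \<forall>i. x $ i \<in> \<int>}"

text \<open>The infimum is over a closed discrete nonempty set, hence attained. The scalar
  \<open>\<bar>x\<bar>\<^sub>\<int>\<close> is written \<open>infdist x \<int>\<close> below.\<close>

definition dist_int_vecs :: "real^'k \<Rightarrow> real" where
  "dist_int_vecs x = (INF z\<in>int_vecs. infnorm (x - z))"

text \<open>The filter \<open>q \<in> \<int>\<^sup>k\<close>, \<open>\<parallel>q\<parallel> \<rightarrow> \<infinity>\<close>.\<close>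

definition int_vecs_at_infinity :: "(real^'k) filter" where
  "int_vecs_at_infinity = inf (filtercomap infnorm at_top) (principal int_vecs)"

definition badly_approximable :: "real \<Rightarrow> real^'n^'m \<Rightarrow> real^'m \<Rightarrow> bool" where
  "badly_approximable \<epsilon> A b \<longleftrightarrow>
     Liminf int_vecs_at_infinity
       (\<lambda>q. ereal (infnorm q powr (real CARD('n) / real CARD('m)) * dist_int_vecs (A *v q - b)))
     \<ge> ereal \<epsilon>"

definition Bad :: "real \<Rightarrow> ((real^'n^'m) \<times> (real^'m)) set" where
  "Bad \<epsilon> = {(A, b). badly_approximable \<epsilon> A b}"

definition Bad_fiber :: "real^'m \<Rightarrow> real \<Rightarrow> (real^'n^'m) set" where
  "Bad_fiber b \<epsilon> = {A. (A, b) \<in> Bad \<epsilon>}"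

definition infinitely_badly_approximable :: "real^'n^'m \<Rightarrow> real^'m \<Rightarrow> bool" where
  "infinitely_badly_approximable A b \<longleftrightarrow> (\<forall>\<epsilon>>0. badly_approximable \<epsilon> A b)"

definition Bad_infinity :: "((real^'n^'m) \<times> (real^'m)) set" where
  "Bad_infinity = (\<Inter>\<epsilon>\<in>{0<..}. Bad \<epsilon>)"

definition Bad_fiber_infinity :: "real^'m \<Rightarrow> (real^'n^'m) set" where
  "Bad_fiber_infinity b = (\<Inter>\<epsilon>\<in>{0<..}. Bad_fiber b \<epsilon>)"

text \<open>The matrix argument \<open>B\<close> is the \<open>n \<times> m\<close> matrix that plays the role of the transpose.\<close>

definition singular_for :: "real^'m \<Rightarrow> real^'m^'n \<Rightarrow> bool" where
  "singular_for b B \<longleftrightarrow>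
     (\<forall>\<epsilon>>0. \<forall>\<^sub>F X :: real in at_top. \<exists>y\<in>int_vecs.
        dist_int_vecs (B *v y)
          < \<epsilon> * infdist (b \<bullet> y) \<int> * X powr (- (real CARD('m) / real CARD('n)))
        \<and> infnorm y < infdist (b \<bullet> y) \<int> * X)"

definition Sing :: "real^'m \<Rightarrow> (real^'n^'m) set" where
  "Sing b = {A. singular_for b (transpose A)}"

end

theory Submission
  imports Defs
begin

text \<open>
  If \<open>y\<close> solves the dual system at \<open>X\<close>, then writing \<open>b \<bullet> y\<close> modulo 1 as
  \<open>(\<^sup>tA y) \<bullet> q - (A q - b) \<bullet> y\<close> bounds \<open>\<parallel>A q - b\<parallel>\<^sub>\<int>\<close> from below for the \<open>q\<close> of size comparable to
  \<open>\<epsilon>\<^sup>-\<^sup>1 X\<^bsup>m/n\<^esup>\<close>; so singularity implies infinite bad approximability.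

  Conversely, if the dual system has no solution at \<open>X\<close>, then \<open>y \<mapsto> b \<bullet> y mod 1\<close> is a character of the
  lattice of vectors \<open>(X\<^sup>-\<^sup>1 y, \<epsilon>\<^sup>-\<^sup>1 X\<^bsup>m/n\<^esup> (\<^sup>tA y - p))\<close> that is bounded by the norm. Such a character is
  given by the inner product with a vector of bounded length, and the coordinates of this vector
  provide \<open>q\<close> with \<open>\<parallel>q\<parallel> \<lless> \<epsilon>\<^sup>-\<^sup>1 X\<^bsup>m/n\<^esup>\<close> and \<open>\<parallel>A q - b\<parallel>\<^sub>\<int> \<lless> X\<^sup>-\<^sup>1\<close>. If these \<open>q\<close> stay bounded as
  \<open>X \<rightarrow> \<infinity>\<close>, then \<open>b \<in> A q + \<int>\<^sup>m\<close> for one of them, and Dirichlet's theorem takes over.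
\<close>

section \<open>Distance to the nearest integer\<close>

lemma infdist_Ints_eq: "infdist x \<int> = \<bar>x - of_int (round x)\<bar>" for x :: real
proof (rule antisym)
  show "infdist x \<int> \<le> \<bar>x - of_int (round x)\<bar>"
    using infdist_le[of "of_int (round x)" \<int> x] by (simp add: dist_real_def)
  show "\<bar>x - of_int (round x)\<bar> \<le> infdist x \<int>"
    by (subst infdist_notempty) (auto simp: dist_real_def elim!: Ints_cases
        intro!: cINF_greatest round_diff_minimal intro: Ints_0)
qed

lemma infdist_Ints_le: "k \<in> \<int> \<Longrightarrow> infdist x \<int> \<le> \<bar>x - k\<bar>" for x :: real
  using infdist_le[of k \<int> x] by (simp add: dist_real_def)

lemma infdist_Ints_add: "infdist (x + y) \<int> \<le> infdist x \<int> + \<bar>y\<bar>" for x y :: real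
  using infdist_triangle[of "x + y" \<int> x] by (simp add: dist_real_def)

lemma Ints_if_infdist_le_0: "infdist x \<int> \<le> 0 \<Longrightarrow> x \<in> \<int>" for x :: real
  unfolding infdist_Ints_eq
  by (metis Ints_of_int abs_le_zero_iff eq_iff_diff_eq_0)

section \<open>Characters modulo 1 on discrete subgroups\<close>

lemma subgroup_of_int_scaleR:
  fixes M :: "'a::real_vector set"
  assumes diff: "\<And>u v. u \<in> M \<Longrightarrow> v \<in> M \<Longrightarrow> u - v \<in> M" and "w \<in> M"
  shows "of_int k *\<^sub>R w \<in> M"
proof -
  have 0: "0 \<in> M" using diff[OF \<open>w \<in> M\<close> \<open>w \<in> M\<close>] by simp
  have neg: "- u \<in> M" if "u \<in> M" for u using diff[OF 0 that] by simp
  have nat: "real n *\<^sub>R w \<in> M" for n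
  proof (induction n)
    case (Suc n)
    then show ?case using diff[OF Suc neg[OF \<open>w \<in> M\<close>]] by (simp add: algebra_simps)
  qed (simp add: 0)
  show ?thesis
    by (cases k rule: int_cases2) (use nat neg[OF nat] in auto)
qed

text \<open>The points of \<open>M\<close> at which \<open>f\<close> is integral form a subgroup
  themselves, because \<open>f\<close> is additive modulo 1.\<close>

lemma additive_mod_Ints_of_int_scaleR:
  fixes M :: "'a::real_vector set" and f :: "'a \<Rightarrow> real"
  assumes diff: "\<And>u v. u \<in> M \<Longrightarrow> v \<in> M \<Longrightarrow> u - v \<in> M"
    and add: "\<And>u v. u \<in> M \<Longrightarrow> v \<in> M \<Longrightarrow> f (u - v) - (f u - f v) \<in> \<int>"
    and "w \<in> M" "f w \<in> \<int>"
  shows "f (of_int k *\<^sub>R w) \<in> \<int>"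
proof -
  let ?M = "{v \<in> M. f v \<in> \<int>}"
  have "u - v \<in> ?M" if "u \<in> ?M" "v \<in> ?M" for u v
  proof -
    have "(f (u - v) - (f u - f v)) + (f u - f v) \<in> \<int>"
      using that by (intro Ints_add Ints_diff add) auto
    then show ?thesis using that diff by simp
  qed
  from subgroup_of_int_scaleR[OF this, of w k] show ?thesis using assms by auto
qed

text \<open>A vector of almost minimal length is as good as a shortest one, and its existence needs
  no compactness.\<close>

lemma near_shortest_vector:
  fixes M :: "'a::real_normed_vector set"
  assumes "r > 0" "\<And>w. w \<in> M \<Longrightarrow> w \<noteq> 0 \<Longrightarrow> r \<le> norm w" "\<not> M \<subseteq> {0}"
  obtains w where "w \<in> M" "w \<noteq> 0" "\<And>v. v \<in> M \<Longrightarrow> v \<noteq> 0 \<Longrightarrow> 4 / 5 * norm w \<le> norm v"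
proof -
  define l where "l = Inf (norm ` (M - {0}))"
  have ne: "norm ` (M - {0}) \<noteq> {}" using assms(3) by auto
  have bdd: "bdd_below (norm ` (M - {0}))" by (intro bdd_belowI[of _ r]) (use assms in auto)
  have "r \<le> l" unfolding l_def using assms by (intro cInf_greatest[OF ne]) auto
  then have "l < 5 / 4 * l" using \<open>r > 0\<close> by simp
  then obtain w where w: "w \<in> M" "w \<noteq> 0" "norm w < 5 / 4 * l"
    unfolding l_def using cInf_lessD[OF ne] by blast
  have "4 / 5 * norm w \<le> norm v" if "v \<in> M" "v \<noteq> 0" for v
    using cInf_lower[OF _ bdd, of "norm v"] that w(3) unfolding l_def by auto
  with w that show thesis by blast
qed

text \<open>Induction on the rank: subtracting a multiple of an almost shortest vector \<open>w\<close> makes the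
  character trivial on \<open>w\<close>, so that it descends to the projection of \<open>M\<close> along \<open>w\<close>. The projection
  stays discrete because every one of its points lifts to a vector at most twice as long.\<close>

theorem character_of_discrete_subgroup:
  fixes M :: "'a::euclidean_space set" and f :: "'a \<Rightarrow> real"
  assumes diff: "\<And>u v. u \<in> M \<Longrightarrow> v \<in> M \<Longrightarrow> u - v \<in> M"
    and "r > 0" and discrete: "\<And>w. w \<in> M \<Longrightarrow> w \<noteq> 0 \<Longrightarrow> r \<le> norm w"
    and add: "\<And>u v. u \<in> M \<Longrightarrow> v \<in> M \<Longrightarrow> f (u - v) - (f u - f v) \<in> \<int>"
    and "\<gamma> \<ge> 0" and small: "\<And>w. w \<in> M \<Longrightarrow> infdist (f w) \<int> \<le> \<gamma> * norm w"
  shows "\<exists>e. norm e \<le> 5 ^ dim M * \<gamma> \<and> (\<forall>w\<in>M. f w - w \<bullet> e \<in> \<int>)"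
  using assms
proof (induction "dim M" arbitrary: M f r \<gamma> rule: less_induct)
  case less
  note diff = less.prems(1) and discrete = less.prems(3) and add = less.prems(4)
    and small = less.prems(6)
  show ?case
  proof (cases "M \<subseteq> {0}")
    case True
    \<comment> \<open>At \<open>w = 0\<close> the bound \<open>small\<close> leaves
      \<open>f w\<close> no distance from the integers.\<close>
    then have "f w - w \<bullet> 0 \<in> \<int>" if "w \<in> M" for w
      using small[OF that] that True by (force intro: Ints_if_infdist_le_0)
    then show ?thesis using \<open>\<gamma> \<ge> 0\<close> by (intro exI[of _ 0]) auto
  next
    case False
    obtain w where w: "w \<in> M" "w \<noteq> 0" and short: "\<And>v. v \<in> M \<Longrightarrow> v \<noteq> 0 \<Longrightarrow> 4 / 5 * norm w \<le> norm v"
      using near_shortest_vector[OF \<open>r > 0\<close> discrete False] by blast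
    define s where "s = norm w"
    have "s > 0" using w by (simp add: s_def)
    have ww: "w \<bullet> w = s\<^sup>2" by (simp add: s_def power2_norm_eq_inner)
    \<comment> \<open>\<open>c v\<close> is the coefficient of \<open>v\<close> along
      \<open>w\<close>, and \<open>P\<close> is the orthogonal projection onto the complement of
      \<open>w\<close>.\<close>
    define c where "c v = (v \<bullet> w) / s\<^sup>2" for v
    define P where "P v = v - c v *\<^sub>R w" for v
    have c_diff: "c (u - v) = c u - c v" for u v
      by (simp add: c_def inner_diff_left diff_divide_distrib)
    have c_scale: "c (a *\<^sub>R w) = a" for a using \<open>s > 0\<close> by (simp add: c_def ww)
    have P_diff: "P (u - v) = P u - P v" for u v
      by (simp add: P_def c_diff algebra_simps)
    have P_scale: "P (a *\<^sub>R w) = 0" for a by (simp add: P_def c_scale)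
    have P_orth: "P v \<bullet> w = 0" for v
      using \<open>s > 0\<close> by (simp add: P_def c_def ww inner_diff_left)
    have P_sym: "u \<bullet> P v = P u \<bullet> v" for u v
      by (simp add: P_def c_def inner_diff_left inner_diff_right inner_commute)
    have pyth: "(norm v)\<^sup>2 = (norm (P v))\<^sup>2 + (c v)\<^sup>2 * s\<^sup>2" for v
    proof -
      have "v = P v + c v *\<^sub>R w" by (simp add: P_def)
      then have "v \<bullet> v = (P v + c v *\<^sub>R w) \<bullet> (P v + c v *\<^sub>R w)" by simp
      also have "\<dots> = P v \<bullet> P v + (c v)\<^sup>2 * (w \<bullet> w)"
        using P_orth[of v] by (simp add: inner_add_left inner_add_right inner_commute power2_eq_square)
      finally show ?thesis by (simp add: power2_norm_eq_inner ww)
    qed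
    have P_norm: "norm (P v) \<le> norm v" for v
    proof (rule power2_le_imp_le)
      show "(norm (P v))\<^sup>2 \<le> (norm v)\<^sup>2" unfolding pyth[of v] by simp
    qed simp
    \<comment> \<open>Rounding \<open>c v\<close> leaves a component of length at most
      \<open>s / 2\<close> along \<open>w\<close>. A nonzero remainder \<open>u\<close> has length
      at least \<open>4 / 5 * s\<close>, so this component carries at most 25/64 of its squared
      length, and the projection keeps more than a quarter.\<close>
    have reduce: "\<exists>k::int. v - of_int k *\<^sub>R w \<in> M \<and> norm (v - of_int k *\<^sub>R w) \<le> 2 * norm (P v)"
      if "v \<in> M" for v
    proof -
      define u where "u = v - of_int (round (c v)) *\<^sub>R w"
      have uM: "u \<in> M"
        unfolding u_def using diff subgroup_of_int_scaleR[OF diff w(1)] that by blast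
      have Pu: "P u = P v" by (simp add: u_def P_diff P_scale)
      have "\<bar>c u\<bar> \<le> 1 / 2"
        unfolding u_def c_diff c_scale using of_int_round_abs_le[of "c v"] by linarith
      then have cu: "(c u)\<^sup>2 * s\<^sup>2 \<le> 1 / 4 * s\<^sup>2"
        using power_mono[of "\<bar>c u\<bar>" "1 / 2" 2]
        by (intro mult_right_mono) (auto simp: power2_eq_square)
      have "norm u \<le> 2 * norm (P u)"
      proof (cases "u = 0")
        case False
        have "(4 / 5 * s)\<^sup>2 \<le> (norm u)\<^sup>2"
          using short[OF uM False] \<open>s > 0\<close> by (intro power_mono) (auto simp: s_def)
        then have "16 / 25 * s\<^sup>2 \<le> (norm u)\<^sup>2"
          by (simp add: power_mult_distrib power_divide)
        moreover have "(norm (P u))\<^sup>2 \<ge> 0" by simp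
        ultimately have "(norm u)\<^sup>2 \<le> 4 * (norm (P u))\<^sup>2"
          using cu pyth[of u] by linarith
        then have "(norm u)\<^sup>2 \<le> (2 * norm (P u))\<^sup>2" by simp
        then show ?thesis by (rule power2_le_imp_le) simp
      qed simp
      then show ?thesis using uM Pu unfolding u_def by auto
    qed

    \<comment> \<open>\<open>\<rho>\<close> is the signed distance of \<open>f w\<close> to the
      nearest integer, and \<open>e1\<close> is the multiple of \<open>w\<close> with
      \<open>w \<bullet> e1 = \<rho>\<close>. Subtracting the product with \<open>e1\<close>
      therefore makes the value at \<open>w\<close> an integer.\<close>
    define \<rho> where "\<rho> = f w - of_int (round (f w))"
    define e1 where "e1 = (\<rho> / s\<^sup>2) *\<^sub>R w"
    have "\<bar>\<rho>\<bar> \<le> \<gamma> * s"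
      using small[OF w(1)] by (simp add: \<rho>_def s_def infdist_Ints_eq)
    then have e1: "norm e1 \<le> \<gamma>"
      using \<open>s > 0\<close> by (simp add: e1_def field_simps flip: s_def) (simp add: power2_eq_square mult.assoc)
    define g where "g v = f v - v \<bullet> e1" for v
    have "g w \<in> \<int>"
      using \<open>s > 0\<close> by (simp add: g_def e1_def ww \<rho>_def)
    have add1: "g (u - v) - (g u - g v) \<in> \<int>" if "u \<in> M" "v \<in> M" for u v
      using add[OF that] by (simp add: g_def inner_diff_left algebra_simps)
    \<comment> \<open>The reduced form of \<open>u - v\<close> has zero projection, hence length 0,
      so \<open>u - v\<close> is an integer multiple of \<open>w\<close>.\<close>
    have kernel: "g u - g v \<in> \<int>" if uv: "u \<in> M" "v \<in> M" "P u = P v" for u v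
    proof -
      obtain k :: int where k: "norm (u - v - of_int k *\<^sub>R w) \<le> 2 * norm (P (u - v))"
        using reduce[OF diff[OF uv(1,2)]] by blast
      then have "u - v = of_int k *\<^sub>R w" using uv by (simp add: P_diff)
      moreover have "g (of_int k *\<^sub>R w) \<in> \<int>"
        by (rule additive_mod_Ints_of_int_scaleR[OF diff add1 w(1) \<open>g w \<in> \<int>\<close>])
      ultimately have "g (u - v) \<in> \<int>" by simp
      from Ints_diff[OF this add1[OF uv(1,2)]] show ?thesis by simp
    qed

    define M' where "M' = P ` M"
    \<comment> \<open>The chosen lifts \<open>L\<close> are short but need not be additive. By
      \<open>kernel\<close>, \<open>g\<close> modulo 1 does not depend on the lift, so
      \<open>g (L w')\<close> is a character of \<open>M'\<close> all the same.\<close>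
    have "\<exists>u\<in>M. P u = P v \<and> norm u \<le> 2 * norm (P v)" if "v \<in> M" for v
      using reduce[OF that] by (metis P_diff P_scale diff_zero)
    then have "\<forall>w'\<in>M'. \<exists>v. v \<in> M \<and> P v = w' \<and> norm v \<le> 2 * norm w'"
      unfolding M'_def by blast
    from bchoice[OF this] obtain L where L: "\<And>w'. w' \<in> M' \<Longrightarrow> L w' \<in> M"
      "\<And>w'. w' \<in> M' \<Longrightarrow> P (L w') = w'" "\<And>w'. w' \<in> M' \<Longrightarrow> norm (L w') \<le> 2 * norm w'"
      by blast
    have diff': "u - v \<in> M'" if "u \<in> M'" "v \<in> M'" for u v
      using that diff by (auto simp: M'_def simp flip: P_diff)
    have "M' \<subseteq> span M \<inter> {x. w \<bullet> x = 0}"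
      using w(1) P_orth by (auto simp: M'_def P_def inner_commute
          intro!: span_diff span_mul intro: span_base)
    then have "span M' \<subseteq> span M \<inter> {x. w \<bullet> x = 0}"
      by (intro span_minimal subspace_inter subspace_span subspace_hyperplane) auto
    moreover have "w \<in> span M" "w \<notin> {x. w \<bullet> x = 0}" using w by (auto intro: span_base)
    ultimately have dim: "dim M' < dim M" by (intro dim_psubset) blast
    \<comment> \<open>The factor 4 arises because subtracting \<open>e1\<close> doubles the bound on
      the character and lifting doubles the length.\<close>
    have "\<exists>e. norm e \<le> 5 ^ dim M' * (4 * \<gamma>) \<and> (\<forall>w'\<in>M'. g (L w') - w' \<bullet> e \<in> \<int>)"
    proof (rule less.hyps[OF dim diff'])
      \<comment> \<open>A lift of a nonzero point is nonzero, so it has length at least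
        \<open>4 / 5 * s\<close>, and it is at most twice as long as the point.\<close>
      show "2 / 5 * s > 0" using \<open>s > 0\<close> by simp
      show "2 / 5 * s \<le> norm w'" if "w' \<in> M'" "w' \<noteq> 0" for w'
      proof -
        have "L w' \<noteq> 0" using L(2)[OF that(1)] that(2) P_scale[of 0] by auto
        with short[OF L(1)] have "4 / 5 * s \<le> norm (L w')" using that(1) by (simp add: s_def)
        then show ?thesis using L(3)[OF that(1)] by simp
      qed
      show "g (L (u - v)) - (g (L u) - g (L v)) \<in> \<int>" if uv: "u \<in> M'" "v \<in> M'" for u v
      proof -
        have "g (L (u - v)) - g (L u - L v) \<in> \<int>"
          using uv by (intro kernel) (auto simp: L diff' diff P_diff)
        from Ints_add[OF this add1[OF L(1)[OF uv(1)] L(1)[OF uv(2)]]] show ?thesis by (simp add: algebra_simps)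
      qed
      show "4 * \<gamma> \<ge> 0" using \<open>\<gamma> \<ge> 0\<close> by simp
      show "infdist (g (L w')) \<int> \<le> 4 * \<gamma> * norm w'" if "w' \<in> M'" for w'
      proof -
        have "\<bar>- (L w' \<bullet> e1)\<bar> \<le> norm (L w') * \<gamma>"
          using Cauchy_Schwarz_ineq2[of "L w'" e1] mult_left_mono[OF e1, of "norm (L w')"] by simp
        then have "infdist (g (L w')) \<int> \<le> 2 * \<gamma> * norm (L w')"
          using infdist_Ints_add[of "f (L w')" "- (L w' \<bullet> e1)"] small[OF L(1)[OF that]]
          by (simp add: g_def mult.commute mult.left_commute)
        also have "\<dots> \<le> 2 * \<gamma> * (2 * norm w')"
          using L(3)[OF that] \<open>\<gamma> \<ge> 0\<close> by (intro mult_left_mono) auto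
        finally show ?thesis by simp
      qed
    qed
    then obtain e2 where e2: "norm e2 \<le> 5 ^ dim M' * (4 * \<gamma>)"
      "\<And>w'. w' \<in> M' \<Longrightarrow> g (L w') - w' \<bullet> e2 \<in> \<int>" by blast
    show ?thesis
    \<comment> \<open>Since \<open>P\<close> is self-adjoint, pairing \<open>v\<close> with
      \<open>P e2\<close> is pairing \<open>P v\<close> with \<open>e2\<close>. The norms add up to
      at most (1 + 4 * 5 ^ \<open>dim M'\<close>) * \<open>\<gamma>\<close>, which is where the base
      5 comes from.\<close>
    proof (intro exI[of _ "e1 + P e2"] conjI ballI)
      have "norm (e1 + P e2) \<le> \<gamma> + 5 ^ dim M' * (4 * \<gamma>)"
        using norm_triangle_ineq[of e1 "P e2"] e1 e2(1) P_norm[of e2] by linarith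
      also have "\<dots> \<le> 5 ^ Suc (dim M') * \<gamma>"
        using mult_right_mono[OF one_le_power[of "5::real" "dim M'"] \<open>\<gamma> \<ge> 0\<close>] by (simp add: mult.commute)
      also have "\<dots> \<le> 5 ^ dim M * \<gamma>"
        using dim \<open>\<gamma> \<ge> 0\<close> by (intro mult_right_mono power_increasing) auto
      finally show "norm (e1 + P e2) \<le> 5 ^ dim M * \<gamma>" .
      fix v assume v: "v \<in> M"
      then have Pv: "P v \<in> M'" by (simp add: M'_def)
      have "g v - g (L (P v)) \<in> \<int>"
        using v Pv L by (intro kernel) auto
      from Ints_add[OF this e2(2)[OF Pv]]
      show "f v - v \<bullet> (e1 + P e2) \<in> \<int>"
        by (simp add: g_def P_sym inner_add_right algebra_simps)
    qed
  qed
qed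

section \<open>Integer vectors and the maximum norm\<close>

lemma int_vecs_0 [simp]: "0 \<in> int_vecs"
  by (simp add: int_vecs_def)

lemma int_vecs_add: "x \<in> int_vecs \<Longrightarrow> y \<in> int_vecs \<Longrightarrow> x + y \<in> int_vecs"
  by (simp add: int_vecs_def)

lemma int_vecs_diff: "x \<in> int_vecs \<Longrightarrow> y \<in> int_vecs \<Longrightarrow> x - y \<in> int_vecs"
  by (simp add: int_vecs_def)

lemma int_vecs_of_nat_scaleR: "x \<in> int_vecs \<Longrightarrow> real k *\<^sub>R x \<in> int_vecs"
  by (simp add: int_vecs_def)

lemma axis_in_int_vecs: "axis i 1 \<in> int_vecs"
  by (simp add: int_vecs_def axis_def)

lemma inner_int_vecs: "x \<in> int_vecs \<Longrightarrow> y \<in> int_vecs \<Longrightarrow> x \<bullet> y \<in> \<int>"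
  by (auto simp: int_vecs_def inner_vec_def intro!: Ints_sum Ints_mult)

lemma infnorm_le_cart: "(\<And>i. \<bar>x $ i\<bar> \<le> c) \<Longrightarrow> infnorm x \<le> c" for x :: "real^'n"
  unfolding infnorm_cart by (rule cSup_least) auto

lemma one_le_infnorm_int_vecs:
  fixes x :: "real^'n"
  assumes "x \<in> int_vecs" "x \<noteq> 0"
  shows "1 \<le> infnorm x"
proof -
  obtain i where "x $ i \<noteq> 0" using \<open>x \<noteq> 0\<close> by (auto simp: vec_eq_iff)
  then have "1 \<le> \<bar>x $ i\<bar>"
    using \<open>x \<in> int_vecs\<close> by (intro Ints_nonzero_abs_ge1) (auto simp: int_vecs_def)
  then show ?thesis using component_le_infnorm_cart[of x i] by linarith
qed

lemma finite_int_vecs_infnorm_le: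
  "finite {x :: real^'n. x \<in> int_vecs \<and> infnorm x \<le> r}"
proof (rule finite_subset)
  let ?F = "\<Pi>\<^sub>E i\<in>(UNIV :: 'n set). {- \<lceil>r\<rceil>..\<lceil>r\<rceil>}"
  show "finite ((\<lambda>h. \<chi> i. real_of_int (h i)) ` ?F)"
    by (intro finite_imageI finite_PiE) auto
  show "{x :: real^'n. x \<in> int_vecs \<and> infnorm x \<le> r} \<subseteq> (\<lambda>h. \<chi> i. real_of_int (h i)) ` ?F"
  proof clarify
    fix x :: "real^'n" assume x: "x \<in> int_vecs" "infnorm x \<le> r"
    have eq: "real_of_int \<lfloor>x $ i\<rfloor> = x $ i" for i
      using x(1) by (simp add: int_vecs_def)
    have "\<lfloor>x $ i\<rfloor> \<in> {- \<lceil>r\<rceil>..\<lceil>r\<rceil>}" for i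
    proof -
      have "\<bar>real_of_int \<lfloor>x $ i\<rfloor>\<bar> \<le> of_int \<lceil>r\<rceil>"
        using component_le_infnorm_cart[of x i] x(2) le_of_int_ceiling[of r] unfolding eq by linarith
      then show ?thesis by auto
    qed
    then show "x \<in> (\<lambda>h. \<chi> i. real_of_int (h i)) ` ?F"
      by (intro image_eqI[of _ _ "\<lambda>i. \<lfloor>x $ i\<rfloor>"]) (auto simp: vec_eq_iff eq)
  qed
qed

lemma abs_inner_le_infnorm:
  fixes x y :: "real^'n"
  shows "\<bar>x \<bullet> y\<bar> \<le> real CARD('n) * infnorm x * infnorm y"
proof -
  have "\<bar>x \<bullet> y\<bar> \<le> (\<Sum>i\<in>UNIV. \<bar>x $ i * y $ i\<bar>)"
    unfolding inner_vec_def by simp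
  also have "\<dots> \<le> (\<Sum>i\<in>(UNIV :: 'n set). infnorm x * infnorm y)"
    unfolding abs_mult
    by (intro sum_mono mult_mono component_le_infnorm_cart infnorm_pos_le) simp
  finally show ?thesis by simp
qed

lemma dist_int_vecs_le: "z \<in> int_vecs \<Longrightarrow> dist_int_vecs x \<le> infnorm (x - z)"
  unfolding dist_int_vecs_def
  by (rule cINF_lower) (auto intro!: bdd_belowI[of _ 0] infnorm_pos_le)

text \<open>In the maximum norm, rounding every coordinate separately minimizes all coordinate
  distances at once.\<close>

lemma dist_int_vecs_attained:
  obtains z where "z \<in> int_vecs" "dist_int_vecs x = infnorm (x - z)"
proof
  define z where "z = (\<chi> i. real_of_int (round (x $ i)))"
  show z: "z \<in> int_vecs" by (simp add: z_def int_vecs_def)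
  have "infnorm (x - z) \<le> infnorm (x - w)" if "w \<in> int_vecs" for w
  proof (rule infnorm_le_cart)
    fix i
    have "\<bar>x $ i - of_int (round (x $ i))\<bar> \<le> \<bar>x $ i - w $ i\<bar>"
      using that infdist_Ints_le[of "w $ i" "x $ i"]
      by (simp add: int_vecs_def infdist_Ints_eq)
    then show "\<bar>(x - z) $ i\<bar> \<le> infnorm (x - w)"
      using component_le_infnorm_cart[of "x - w" i] by (simp add: z_def)
  qed
  then have "infnorm (x - z) \<le> dist_int_vecs x"
    unfolding dist_int_vecs_def by (intro cINF_greatest) (auto intro: int_vecs_0)
  then show "dist_int_vecs x = infnorm (x - z)"
    using dist_int_vecs_le[OF z, of x] by simp
qed

lemma dist_int_vecs_nonneg: "0 \<le> dist_int_vecs x"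
  by (metis dist_int_vecs_attained infnorm_pos_le)

lemma dist_int_vecs_triangle: "dist_int_vecs (x + y) \<le> dist_int_vecs x + dist_int_vecs y"
proof -
  obtain u v where "u \<in> int_vecs" "v \<in> int_vecs"
    "dist_int_vecs x = infnorm (x - u)" "dist_int_vecs y = infnorm (y - v)"
    by (metis dist_int_vecs_attained)
  then show ?thesis
    using dist_int_vecs_le[OF int_vecs_add, of u v "x + y"] infnorm_triangle[of "x - u" "y - v"]
    by (simp add: algebra_simps)
qed

lemma dist_int_vecs_of_nat_scaleR_eq_0:
  assumes "dist_int_vecs x = 0"
  shows "dist_int_vecs (real k *\<^sub>R x) = 0"
proof -
  obtain z where "z \<in> int_vecs" "x = z"
    using assms by (metis dist_int_vecs_attained infnorm_eq_0 right_minus_eq)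
  then show ?thesis
    using dist_int_vecs_le[OF int_vecs_of_nat_scaleR, of z "real k *\<^sub>R x" k]
      dist_int_vecs_nonneg[of "real k *\<^sub>R x"] by (simp add: infnorm_0)
qed

section \<open>Transference between a matrix and its transpose\<close>

lemma inner_transpose_mult: "y \<bullet> (A *v q) = (transpose A *v y) \<bullet> q" for A :: "real^'n^'m"
  by (simp add: dot_lmul_matrix flip: vector_transpose_matrix)

text \<open>With \<open>z\<close> and \<open>p\<close> the integer vectors nearest to
  \<open>A *v q - b\<close> and \<open>transpose A *v y\<close>, the number
  \<open>b \<bullet> y\<close> differs from the integer \<open>p \<bullet> q - z \<bullet> y\<close>
  by exactly \<open>(transpose A *v y - p) \<bullet> q - (A *v q - b - z) \<bullet>
  y\<close>.\<close>

lemma infdist_inner_Ints_le: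
  fixes A :: "real^'n^'m" and b :: "real^'m"
  assumes "q \<in> int_vecs" "y \<in> int_vecs"
  shows "infdist (b \<bullet> y) \<int> \<le> real CARD('m) * dist_int_vecs (A *v q - b) * infnorm y
           + real CARD('n) * dist_int_vecs (transpose A *v y) * infnorm q"
proof -
  obtain z p where zp: "z \<in> int_vecs" "p \<in> int_vecs"
    "dist_int_vecs (A *v q - b) = infnorm (A *v q - b - z)"
    "dist_int_vecs (transpose A *v y) = infnorm (transpose A *v y - p)"
    by (metis dist_int_vecs_attained)
  have "p \<bullet> q - z \<bullet> y \<in> \<int>" using assms zp by (intro Ints_diff inner_int_vecs)
  from infdist_Ints_le[OF this, of "b \<bullet> y"]
  have "infdist (b \<bullet> y) \<int> \<le> \<bar>(transpose A *v y - p) \<bullet> q - (A *v q - b - z) \<bullet> y\<bar>"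
    using inner_transpose_mult[of y A q]
    by (simp add: inner_diff_left inner_commute[of "A *v q"] algebra_simps)
  also have "\<dots> \<le> \<bar>(A *v q - b - z) \<bullet> y\<bar> + \<bar>(transpose A *v y - p) \<bullet> q\<bar>" by linarith
  also have "\<dots> \<le> real CARD('m) * infnorm (A *v q - b - z) * infnorm y
      + real CARD('n) * infnorm (transpose A *v y - p) * infnorm q"
    by (intro add_mono abs_inner_le_infnorm)
  finally show ?thesis using zp by simp
qed

text \<open>\<open>char\<close> bounds the character given by \<open>b\<close> by the norm on the
  lattice of all \<open>\<phi> y p\<close>. The character theorem with \<open>\<gamma> = 1\<close>
  applies, and its constant is at most 5 ^ (m + n) because the lattice lives in dimension m +
  n.\<close>

lemma inhomogeneous_transference:
  fixes A :: "real^'n^'m" and b :: "real^'m"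
  assumes "X > 0" "T > 0"
    and char: "\<And>y. y \<in> int_vecs \<Longrightarrow>
      infdist (b \<bullet> y) \<int> \<le> max (T * dist_int_vecs (transpose A *v y)) (infnorm y / X)"
  shows "\<exists>q\<in>int_vecs. infnorm q \<le> 5 ^ (CARD('m) + CARD('n)) * T
           \<and> dist_int_vecs (A *v q - b) \<le> 5 ^ (CARD('m) + CARD('n)) / X"
proof -
  define D where "D = (5 :: real) ^ (CARD('m) + CARD('n))"
  define \<phi> :: "real^'m \<Rightarrow> real^'n \<Rightarrow> (real^'m) \<times> (real^'n)"
    where "\<phi> y p = ((1 / X) *\<^sub>R y, T *\<^sub>R (transpose A *v y - p))" for y p
  define M where "M = {\<phi> y p |y p. y \<in> int_vecs \<and> p \<in> int_vecs}"
  \<comment> \<open>\<open>f\<close> recovers \<open>y\<close> from the first component, so it is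
    linear on the whole space and does not depend on \<open>p\<close>.\<close>
  define f where "f w = b \<bullet> (X *\<^sub>R fst w)" for w :: "(real^'m) \<times> (real^'n)"
  have f_\<phi>: "f (\<phi> y p) = b \<bullet> y" for y p
    using \<open>X > 0\<close> by (simp add: f_def \<phi>_def)
  have norm_fst: "norm y / X \<le> norm (\<phi> y p)" for y p
    using norm_fst_le[of "(1 / X) *\<^sub>R y" "T *\<^sub>R (transpose A *v y - p)"] \<open>X > 0\<close>
    by (simp add: \<phi>_def)
  have norm_snd: "T * norm (transpose A *v y - p) \<le> norm (\<phi> y p)" for y p
    using norm_snd_le[of "T *\<^sub>R (transpose A *v y - p)" "(1 / X) *\<^sub>R y"] \<open>T > 0\<close>
    by (simp add: \<phi>_def)
  have norm_ge_1: "1 \<le> norm x" if "x \<in> int_vecs" "x \<noteq> 0" for x :: "real^'k"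
    using one_le_infnorm_int_vecs[OF that] infnorm_le_norm[of x] by linarith
  have "\<exists>e. norm e \<le> 5 ^ dim M * 1 \<and> (\<forall>w\<in>M. f w - w \<bullet> e \<in> \<int>)"
  proof (rule character_of_discrete_subgroup)
    fix u v assume "u \<in> M" "v \<in> M"
    then obtain y p y' p' where uv: "u = \<phi> y p" "v = \<phi> y' p'" "y \<in> int_vecs" "p \<in> int_vecs"
      "y' \<in> int_vecs" "p' \<in> int_vecs" by (auto simp: M_def)
    have "u - v = \<phi> (y - y') (p - p')"
      by (simp add: uv \<phi>_def algebra_simps matrix_vector_mult_diff_distrib)
    then show "u - v \<in> M" using uv by (auto simp: M_def intro: int_vecs_diff)
    show "f (u - v) - (f u - f v) \<in> \<int>" by (simp add: f_def algebra_simps inner_diff_right)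
  next
    show "min (1 / X) T > 0" using assms by simp
    fix w assume "w \<in> M" "w \<noteq> 0"
    then obtain y p where w: "w = \<phi> y p" "y \<in> int_vecs" "p \<in> int_vecs" by (auto simp: M_def)
    \<comment> \<open>Either \<open>y\<close> is nonzero and the first component has length at least
      \<open>1 / X\<close>, or the second component is \<open>- T *\<^sub>R p\<close> with
      \<open>p\<close> a nonzero integer vector.\<close>
    show "min (1 / X) T \<le> norm w"
    proof (cases "y = 0")
      case True
      with w \<open>w \<noteq> 0\<close> have "p \<noteq> 0" by (auto simp: \<phi>_def zero_prod_def)
      then have "T * 1 \<le> T * norm p" using norm_ge_1 w \<open>T > 0\<close> by (intro mult_left_mono) auto
      then show ?thesis using norm_snd[of y p] w True by simp
    next
      case False
      then have "1 / X \<le> norm y / X" using norm_ge_1 w \<open>X > 0\<close> by (intro divide_right_mono) auto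
      then show ?thesis using norm_fst[of y p] w by simp
    qed
  next
    fix w assume "w \<in> M"
    then obtain y p where w: "w = \<phi> y p" "y \<in> int_vecs" "p \<in> int_vecs" by (auto simp: M_def)
    have "infnorm y / X \<le> norm y / X"
      using \<open>X > 0\<close> by (intro divide_right_mono infnorm_le_norm) auto
    moreover have "T * dist_int_vecs (transpose A *v y) \<le> T * norm (transpose A *v y - p)"
      using \<open>T > 0\<close> dist_int_vecs_le[OF w(3), of "transpose A *v y"]
        infnorm_le_norm[of "transpose A *v y - p"] by (intro mult_left_mono) auto
    ultimately show "infdist (f w) \<int> \<le> 1 * norm w"
      using char[OF w(2)] norm_fst[of y p] norm_snd[of y p] unfolding w(1) f_\<phi> by linarith
  qed auto
  then obtain e where e: "norm e \<le> 5 ^ dim M" "\<And>w. w \<in> M \<Longrightarrow> f w - w \<bullet> e \<in> \<int>" by auto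
  have "dim M \<le> CARD('m) + CARD('n)" using dim_subset_UNIV[of M] by simp
  then have "(5 :: real) ^ dim M \<le> D" unfolding D_def by (intro power_increasing) auto
  with e(1) have "norm e \<le> D" by linarith
  define e1 e2 where "e1 = fst e" and "e2 = snd e"
  have e12: "norm e1 \<le> D" "norm e2 \<le> D"
    using \<open>norm e \<le> D\<close> norm_fst_le[of e1 e2] norm_snd_le[of e2 e1] by (auto simp: e1_def e2_def)
  have int: "b \<bullet> y - (y \<bullet> e1) / X - (transpose A *v y - p) \<bullet> (T *\<^sub>R e2) \<in> \<int>"
    if "y \<in> int_vecs" "p \<in> int_vecs" for y p
  proof -
    have "\<phi> y p \<in> M" using that by (auto simp: M_def)
    from e(2)[OF this] show ?thesis
      unfolding f_\<phi> by (simp add: \<phi>_def inner_prod_def e1_def e2_def algebra_simps)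
  qed
  define q where "q = T *\<^sub>R e2"
  \<comment> \<open>Testing the character on \<open>y = 0\<close> and a unit vector \<open>p\<close>
    isolates one coordinate of \<open>q\<close>.\<close>
  have q: "q \<in> int_vecs"
    unfolding int_vecs_def
  proof clarify
    fix i
    show "q $ i \<in> \<int>"
      using int[OF int_vecs_0 axis_in_int_vecs, of i] by (simp add: inner_axis' q_def)
  qed
  \<comment> \<open>Testing on a unit vector \<open>y\<close> and \<open>p = 0\<close> shows that
    \<open>e1 / X\<close> is, up to sign, the error of \<open>A *v q\<close> against
    \<open>b\<close> modulo integer vectors.\<close>
  have z: "A *v q - b + (1 / X) *\<^sub>R e1 \<in> int_vecs"
    unfolding int_vecs_def
  proof clarify
    fix i
    have "b \<bullet> axis i 1 - (axis i 1 \<bullet> e1) / X - axis i 1 \<bullet> (A *v q) \<in> \<int>"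
      using int[OF axis_in_int_vecs int_vecs_0, of i] by (simp add: inner_transpose_mult q_def)
    from Ints_minus[OF this] show "(A *v q - b + (1 / X) *\<^sub>R e1) $ i \<in> \<int>"
      by (simp add: inner_axis inner_axis' algebra_simps)
  qed
  have "dist_int_vecs (A *v q - b) \<le> infnorm ((1 / X) *\<^sub>R e1)"
    using dist_int_vecs_le[OF z, of "A *v q - b"] by (simp add: infnorm_neg)
  also have "\<dots> \<le> norm e1 / X"
    using infnorm_le_norm[of "(1 / X) *\<^sub>R e1"] \<open>X > 0\<close> by simp
  also have "\<dots> \<le> D / X" using e12 \<open>X > 0\<close> by (intro divide_right_mono) auto
  finally have "dist_int_vecs (A *v q - b) \<le> D / X" .
  moreover have "infnorm q \<le> D * T"
  proof -
    have "norm q = norm e2 * T" using \<open>T > 0\<close> by (simp add: q_def)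
    also have "\<dots> \<le> D * T" using e12(2) \<open>T > 0\<close> by (intro mult_right_mono) auto
    finally show ?thesis using infnorm_le_norm[of q] by linarith
  qed
  ultimately show ?thesis using q unfolding D_def by blast
qed

section \<open>Dirichlet's theorem\<close>

text \<open>Pigeonhole: N ^ n integer points of a box are sent by \<open>A\<close> modulo 1 into K ^
  m cubes of side 1 / K. Two points in the same cube have the required difference.\<close>

lemma dirichlet_approximation:
  fixes A :: "real^'n^'m"
  assumes "K > 0" "K ^ CARD('m) < N ^ CARD('n)"
  shows "\<exists>q\<in>int_vecs. q \<noteq> 0 \<and> infnorm q \<le> real N \<and> dist_int_vecs (A *v q) \<le> 1 / real K"
proof -
  define S where "S = (\<Pi>\<^sub>E i\<in>(UNIV :: 'n set). {..<N})"
  define T where "T = (\<Pi>\<^sub>E i\<in>(UNIV :: 'm set). {..<K})"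
  define v where "v h = (\<chi> i. real (h i))" for h :: "'n \<Rightarrow> nat"
  define cell where "cell h = (\<lambda>i. nat \<lfloor>real K * frac ((A *v v h) $ i)\<rfloor>)" for h
  have "cell h \<in> T" for h
  proof -
    have "real K * frac x < real K" for x
      using mult_strict_left_mono[OF frac_lt_1[of x], of "real K"] \<open>K > 0\<close> by simp
    then have "\<lfloor>real K * frac x\<rfloor> < int K" for x by (simp add: floor_less_iff)
    then show ?thesis using \<open>K > 0\<close> by (auto simp: T_def cell_def nat_less_iff)
  qed
  moreover have "card T < card S"
    using assms(2) by (simp add: S_def T_def card_PiE)
  moreover have "finite T" by (auto simp: T_def intro: finite_PiE)
  ultimately have "\<not> inj_on cell S"
    by (intro pigeonhole) (meson card_mono image_subset_iff le_less_trans)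
  then obtain h h' where h: "h \<in> S" "h' \<in> S" "cell h = cell h'" "h \<noteq> h'"
    by (auto simp: inj_on_def)
  define q where "q = v h - v h'"
  have "q \<in> int_vecs" by (simp add: q_def v_def int_vecs_def)
  moreover have "q \<noteq> 0" using h(4) by (auto simp: q_def v_def vec_eq_iff)
  moreover have "infnorm q \<le> real N"
  proof (rule infnorm_le_cart)
    fix i
    have "h i < N" "h' i < N" using h(1,2) by (auto simp: S_def)
    then show "\<bar>q $ i\<bar> \<le> real N" by (simp add: q_def v_def)
  qed
  moreover have "dist_int_vecs (A *v q) \<le> 1 / real K"
  proof -
    define z where "z = (\<chi> i. real_of_int (\<lfloor>(A *v v h) $ i\<rfloor> - \<lfloor>(A *v v h') $ i\<rfloor>))"
    have "z \<in> int_vecs" by (simp add: z_def int_vecs_def)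
    then have "dist_int_vecs (A *v q) \<le> infnorm (A *v q - z)" by (rule dist_int_vecs_le)
    also have "\<dots> \<le> 1 / real K"
    proof (rule infnorm_le_cart)
      fix i
      let ?x = "(A *v v h) $ i" and ?y = "(A *v v h') $ i"
      have "nat \<lfloor>real K * frac ?x\<rfloor> = nat \<lfloor>real K * frac ?y\<rfloor>"
        using h(3) by (auto simp: cell_def dest: fun_cong)
      then have "\<lfloor>real K * frac ?x\<rfloor> = \<lfloor>real K * frac ?y\<rfloor>"
        by (subst (asm) eq_nat_nat_iff) auto
      then have "\<bar>real K * frac ?x - real K * frac ?y\<bar> \<le> 1" by linarith
      then have "real K * \<bar>frac ?x - frac ?y\<bar> \<le> 1"
        by (simp add: abs_mult flip: right_diff_distrib)
      moreover have "(A *v q - z) $ i = frac ?x - frac ?y"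
        by (simp add: q_def z_def frac_def matrix_vector_mult_diff_distrib)
      ultimately show "\<bar>(A *v q - z) $ i\<bar> \<le> 1 / real K"
        using \<open>K > 0\<close> by (simp only: le_divide_eq mult.commute) simp
    qed
    finally show ?thesis .
  qed
  ultimately show ?thesis by blast
qed

lemma dirichlet_approximation_powr:
  fixes A :: "real^'n^'m"
  assumes "2 \<le> real N powr (real CARD('n) / real CARD('m))"
  shows "\<exists>q\<in>int_vecs. q \<noteq> 0 \<and> infnorm q \<le> real N
           \<and> dist_int_vecs (A *v q) \<le> 2 / real N powr (real CARD('n) / real CARD('m))"
proof -
  define B where "B = real N powr (real CARD('n) / real CARD('m))"
  \<comment> \<open>The largest integer strictly below \<open>B\<close>, also when \<open>B\<close>
    is an integer, since the pigeonhole count must be strict. As \<open>B \<ge> 2\<close>, it is at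
    least \<open>B / 2\<close>.\<close>
  define K where "K = nat (\<lceil>B\<rceil> - 1)"
  have "B \<ge> 2" using assms by (simp add: B_def)
  then have "N > 0" by (cases N) (auto simp: B_def)
  have K: "real K < B" "B \<le> real K + 1" "K > 0"
    using \<open>B \<ge> 2\<close> by (auto simp: K_def) linarith+
  have "real K ^ CARD('m) < B ^ CARD('m)" using K by (intro power_strict_mono) auto
  also have "\<dots> = real N ^ CARD('n)"
    using \<open>N > 0\<close> by (simp add: B_def powr_powr flip: powr_realpow)
  finally have "K ^ CARD('m) < N ^ CARD('n)"
    by (metis of_nat_less_iff of_nat_power)
  from dirichlet_approximation[OF K(3) this, of A] obtain q where
    q: "q \<in> int_vecs" "q \<noteq> 0" "infnorm q \<le> real N" "dist_int_vecs (A *v q) \<le> 1 / real K"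
    by blast
  have "1 / real K \<le> 2 / B" using K \<open>B \<ge> 2\<close> by (simp add: field_simps)
  then show ?thesis using q unfolding B_def by force
qed

lemma finite_pos_lower_bound:
  fixes f :: "'a \<Rightarrow> real"
  assumes "finite S" "\<And>x. x \<in> S \<Longrightarrow> f x > 0"
  obtains \<mu> where "\<mu> > 0" "\<And>x. x \<in> S \<Longrightarrow> \<mu> \<le> f x"
proof
  \<comment> \<open>The inserted 1 covers the case of an empty \<open>S\<close>.\<close>
  show "Min (insert 1 (f ` S)) > 0" using assms by simp
  show "Min (insert 1 (f ` S)) \<le> f x" if "x \<in> S" for x using assms that by simp
qed

text \<open>Dirichlet's theorem bounds \<open>q\<close> only from above. If some small nonzero
  \<open>q\<close> makes \<open>A *v q\<close> integral, its multiples are arbitrarily large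
  solutions. Otherwise the finitely many small \<open>q\<close> have distances bounded away from 0,
  and a fine enough approximation cannot be one of them.\<close>

lemma dirichlet_unbounded:
  fixes A :: "real^'n^'m"
  shows "\<exists>q\<in>int_vecs. R \<le> infnorm q
           \<and> infnorm q powr (real CARD('n) / real CARD('m)) * dist_int_vecs (A *v q) \<le> 2"
proof (rule ccontr)
  define a where "a = real CARD('n) / real CARD('m)"
  have "a > 0" by (simp add: a_def)
  assume "\<not> ?thesis"
  then have neg: "2 < infnorm q powr a * dist_int_vecs (A *v q)"
    if "q \<in> int_vecs" "R \<le> infnorm q" for q
    using that by (auto simp: a_def not_le)
  define S where "S = {q :: real^'n. q \<in> int_vecs \<and> infnorm q \<le> R} - {0}"
  have pos: "dist_int_vecs (A *v q) > 0" if "q \<in> S" for q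
  proof (rule ccontr)
    assume "\<not> dist_int_vecs (A *v q) > 0"
    then have 0: "dist_int_vecs (A *v q) = 0"
      using dist_int_vecs_nonneg[of "A *v q"] by linarith
    obtain k :: nat where "R \<le> real k" using real_arch_simple by blast
    also have "\<dots> \<le> infnorm (real k *\<^sub>R q)"
      using that mult_left_mono[OF one_le_infnorm_int_vecs[of q], of "real k"]
      by (auto simp: S_def infnorm_mul)
    finally have "R \<le> infnorm (real k *\<^sub>R q)" .
    with that have "2 < infnorm (real k *\<^sub>R q) powr a * dist_int_vecs (A *v (real k *\<^sub>R q))"
      by (intro neg) (auto simp: S_def intro: int_vecs_of_nat_scaleR)
    moreover have "dist_int_vecs (A *v (real k *\<^sub>R q)) = 0"
      using dist_int_vecs_of_nat_scaleR_eq_0[OF 0] by (simp add: matrix_vector_mult_scaleR)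
    ultimately show False by simp
  qed
  have "finite S" unfolding S_def using finite_int_vecs_infnorm_le by blast
  from finite_pos_lower_bound[OF this, of "\<lambda>q. dist_int_vecs (A *v q)", OF pos] obtain \<mu> where \<mu>: "\<mu> > 0" "\<And>q. q \<in> S \<Longrightarrow> \<mu> \<le> dist_int_vecs (A *v q)"
    by blast
  \<comment> \<open>The 2 is what the approximation lemma requires; \<open>4 / \<mu>\<close> pushes
    its bound \<open>2 / B\<close> down to \<open>\<mu> / 2\<close>.\<close>
  define B where "B = max 2 (4 / \<mu>)"
  have "B > 0" by (simp add: B_def less_max_iff_disj)
  obtain N :: nat where N: "B powr (1 / a) \<le> real N" using real_arch_simple by blast
  have "B = (B powr (1 / a)) powr a"
    using \<open>a > 0\<close> by (simp add: powr_powr B_def)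
  also have "\<dots> \<le> real N powr a" using N \<open>a > 0\<close> by (intro powr_mono2) auto
  finally have B: "B \<le> real N powr a" .
  then have "2 \<le> real N powr a" by (simp add: B_def)
  then have "0 < real N powr a" by linarith
  obtain q where q: "q \<in> int_vecs" "q \<noteq> 0" "infnorm q \<le> real N"
    "dist_int_vecs (A *v q) \<le> 2 / real N powr a"
    using dirichlet_approximation_powr[of N A] \<open>2 \<le> real N powr a\<close> unfolding a_def by blast
  show False
  proof (cases "infnorm q \<le> R")
    case True
    with q \<mu>(2) have "\<mu> \<le> 2 / real N powr a" by (force simp: S_def)
    also have "\<dots> \<le> 2 / B"
      using B \<open>B > 0\<close> \<open>0 < real N powr a\<close> by (intro divide_left_mono mult_pos_pos) auto
    also have "\<dots> \<le> 2 / (4 / \<mu>)"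
      using \<mu>(1) \<open>B > 0\<close> by (intro divide_left_mono mult_pos_pos) (auto simp: B_def)
    finally show False using \<mu>(1) by simp
  next
    case False
    then have "2 < infnorm q powr a * dist_int_vecs (A *v q)" using neg q by simp
    also have "\<dots> \<le> real N powr a * (2 / real N powr a)"
      using q \<open>a > 0\<close> by (intro mult_mono powr_mono2) (auto simp: infnorm_pos_le dist_int_vecs_nonneg)
    finally show False using \<open>0 < real N powr a\<close> by simp
  qed
qed

section \<open>Infinite bad approximability\<close>

lemma eventually_int_vecs_at_infinity:
  "eventually P int_vecs_at_infinity \<longleftrightarrow> (\<exists>R. \<forall>q\<in>int_vecs. R \<le> infnorm q \<longrightarrow> P q)"
  unfolding int_vecs_at_infinity_def eventually_inf_principal eventually_filtercomap_at_top_linorder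
  by blast

text \<open>Passing from a bound on the \<open>Liminf\<close> to an eventual strict inequality costs
  replacing \<open>E\<close> by \<open>E + 1\<close>, which is harmless as \<open>E\<close> is
  arbitrary.\<close>

lemma infinitely_badly_approximable_iff:
  fixes A :: "real^'n^'m" and b :: "real^'m"
  shows "infinitely_badly_approximable A b \<longleftrightarrow>
    (\<forall>E>0. \<exists>R. \<forall>q\<in>int_vecs. R \<le> infnorm q \<longrightarrow>
      E < infnorm q powr (real CARD('n) / real CARD('m)) * dist_int_vecs (A *v q - b))"
    (is "_ \<longleftrightarrow> (\<forall>E>0. \<exists>R. \<forall>q\<in>int_vecs. R \<le> infnorm q \<longrightarrow> E < ?g q)")
proof -
  have "infinitely_badly_approximable A b \<longleftrightarrow>
    (\<forall>E>0. \<forall>y<ereal E. eventually (\<lambda>q. y < ereal (?g q)) int_vecs_at_infinity)"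
    by (simp add: infinitely_badly_approximable_def badly_approximable_def le_Liminf_iff)
  also have "\<dots> \<longleftrightarrow> (\<forall>E>0. eventually (\<lambda>q. E < ?g q) int_vecs_at_infinity)"
  proof (intro iffI allI impI)
    fix E :: real
    assume *: "\<forall>E>0. \<forall>y<ereal E. eventually (\<lambda>q. y < ereal (?g q)) int_vecs_at_infinity"
      and "E > 0"
    then have "eventually (\<lambda>q. ereal E < ereal (?g q)) int_vecs_at_infinity"
      using *[rule_format, of "E + 1" "ereal E"] by simp
    then show "eventually (\<lambda>q. E < ?g q) int_vecs_at_infinity" by simp
  next
    fix E :: real and y
    assume *: "\<forall>E>0. eventually (\<lambda>q. E < ?g q) int_vecs_at_infinity"
      and "E > 0" "y < ereal E"
    from *[rule_format, OF \<open>E > 0\<close>]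
    show "eventually (\<lambda>q. y < ereal (?g q)) int_vecs_at_infinity"
      by eventually_elim (use \<open>y < ereal E\<close> in \<open>metis ereal_less_eq(3) less_imp_le order_less_le_trans\<close>)
  qed
  finally show ?thesis unfolding eventually_int_vecs_at_infinity .
qed

text \<open>If \<open>A *v r - b\<close> were integral, shifting by \<open>r\<close> would turn the
  large homogeneous solutions of Dirichlet's theorem into inhomogeneous ones with bounded
  product.\<close>

lemma infinitely_badly_approximable_dist_pos:
  fixes A :: "real^'n^'m" and b :: "real^'m"
  assumes bad: "infinitely_badly_approximable A b" and "r \<in> int_vecs"
  shows "dist_int_vecs (A *v r - b) > 0"
proof (rule ccontr)
  assume "\<not> ?thesis"
  then have 0: "dist_int_vecs (A *v r - b) = 0"
    using dist_int_vecs_nonneg[of "A *v r - b"] by linarith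
  define a where "a = real CARD('n) / real CARD('m)"
  have "a > 0" by (simp add: a_def)
  \<comment> \<open>The last 2 is the Dirichlet bound; \<open>2 powr a\<close> pays for
    \<open>infnorm (q + r) \<le> 2 * infnorm q\<close>.\<close>
  have "(2 :: real) powr a * 2 > 0" by simp
  then obtain R where R: "\<And>q. q \<in> int_vecs \<Longrightarrow> R \<le> infnorm q \<Longrightarrow>
      2 powr a * 2 < infnorm q powr a * dist_int_vecs (A *v q - b)"
    using bad unfolding infinitely_badly_approximable_iff a_def by blast
  obtain q where q: "q \<in> int_vecs" "max (R + infnorm r) (infnorm r) \<le> infnorm q"
    "infnorm q powr a * dist_int_vecs (A *v q) \<le> 2"
    using dirichlet_unbounded[of "max (R + infnorm r) (infnorm r)" A] unfolding a_def by blast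
  have "infnorm q \<le> infnorm (q + r) + infnorm r"
    using infnorm_triangle[of "q + r" "- r"] by (simp add: infnorm_neg)
  then have "2 powr a * 2 < infnorm (q + r) powr a * dist_int_vecs (A *v (q + r) - b)"
    using q assms(2) by (intro R int_vecs_add) auto
  also have "\<dots> \<le> (2 * infnorm q) powr a * dist_int_vecs (A *v q)"
  proof (intro mult_mono powr_mono2)
    show "infnorm (q + r) \<le> 2 * infnorm q" using infnorm_triangle[of q r] q(2) by simp
    have *: "A *v (q + r) - b = A *v q + (A *v r - b)" by (simp add: matrix_vector_right_distrib)
    show "dist_int_vecs (A *v (q + r) - b) \<le> dist_int_vecs (A *v q)"
      unfolding * using dist_int_vecs_triangle[of "A *v q" "A *v r - b"] 0 by linarith
  qed (use \<open>a > 0\<close> in \<open>auto simp: infnorm_pos_le dist_int_vecs_nonneg\<close>)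
  also have "\<dots> = 2 powr a * (infnorm q powr a * dist_int_vecs (A *v q))"
    by (simp add: powr_mult infnorm_pos_le)
  also have "\<dots> \<le> 2 powr a * 2" using q(3) by (intro mult_left_mono) auto
  finally show False by simp
qed

section \<open>The two implications\<close>

lemma singular_for_if_infinitely_badly_approximable:
  fixes A :: "real^'n^'m" and b :: "real^'m"
  assumes bad: "infinitely_badly_approximable A b"
  shows "singular_for b (transpose A)"
proof (rule ccontr)
  define a where "a = real CARD('n) / real CARD('m)"
  have "a > 0" by (simp add: a_def)
  have inv_a: "real CARD('m) / real CARD('n) = 1 / a" by (simp add: a_def)
  define C where "C = (5 :: real) ^ (CARD('m) + CARD('n))"
  have "C > 0" by (simp add: C_def)
  assume "\<not> ?thesis"
  then obtain \<epsilon> where "\<epsilon> > 0" and neg: "\<And>X0. \<exists>X\<ge>X0. \<forall>y\<in>int_vecs.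
      \<not> (dist_int_vecs (transpose A *v y) < \<epsilon> * infdist (b \<bullet> y) \<int> * X powr (- (1 / a))
         \<and> infnorm y < infdist (b \<bullet> y) \<int> * X)"
    unfolding singular_for_def eventually_at_top_linorder inv_a by blast
  \<comment> \<open>This is the value of \<open>(C * T) powr a * (C / X)\<close> for the
    \<open>T\<close> below, in which \<open>X\<close> cancels.\<close>
  define E where "E = (C / \<epsilon>) powr a * C"
  have "E > 0" using \<open>C > 0\<close> \<open>\<epsilon> > 0\<close> by (simp add: E_def)
  then obtain R where R: "\<And>q. q \<in> int_vecs \<Longrightarrow> R \<le> infnorm q \<Longrightarrow>
      E < infnorm q powr a * dist_int_vecs (A *v q - b)"
    using bad unfolding infinitely_badly_approximable_iff a_def by blast
  \<comment> \<open>The bound \<open>R\<close> says nothing about small \<open>q\<close>, but these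
    are finitely many and none has distance 0.\<close>
  obtain \<mu> where \<mu>: "\<mu> > 0"
    "\<And>q. q \<in> int_vecs \<Longrightarrow> infnorm q \<le> R \<Longrightarrow> \<mu> \<le> dist_int_vecs (A *v q - b)"
  proof (rule finite_pos_lower_bound)
    show "finite {q :: real^'n. q \<in> int_vecs \<and> infnorm q \<le> R}"
      by (rule finite_int_vecs_infnorm_le)
    show "dist_int_vecs (A *v q - b) > 0" if "q \<in> {q. q \<in> int_vecs \<and> infnorm q \<le> R}" for q
      using that infinitely_badly_approximable_dist_pos[OF bad] by blast
  qed blast
  \<comment> \<open>For such \<open>X\<close> the error \<open>C / X\<close> is at most
    \<open>\<mu> / 2\<close>, so the vector \<open>q\<close> found by transference is not
    small.\<close>
  obtain X where X: "X \<ge> 2 * C / \<mu>" and Xneg: "\<And>y. y \<in> int_vecs \<Longrightarrow>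
      \<epsilon> * infdist (b \<bullet> y) \<int> * X powr (- (1 / a)) \<le> dist_int_vecs (transpose A *v y)
      \<or> infdist (b \<bullet> y) \<int> * X \<le> infnorm y"
    using neg[of "2 * C / \<mu>"] by (auto simp: not_less)
  have "2 * C / \<mu> > 0" using \<open>C > 0\<close> \<mu>(1) by simp
  then have "X > 0" using X by linarith
  define T where "T = X powr (1 / a) / \<epsilon>"
  have "T > 0" using \<open>X > 0\<close> \<open>\<epsilon> > 0\<close> by (simp add: T_def)
  have "infdist (b \<bullet> y) \<int> \<le> max (T * dist_int_vecs (transpose A *v y)) (infnorm y / X)"
    if "y \<in> int_vecs" for y
    using Xneg[OF that]
  proof
    assume *: "\<epsilon> * infdist (b \<bullet> y) \<int> * X powr (- (1 / a)) \<le> dist_int_vecs (transpose A *v y)"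
    have "T * (\<epsilon> * infdist (b \<bullet> y) \<int> * X powr (- (1 / a)))
        = infdist (b \<bullet> y) \<int> * (X powr (1 / a) * X powr (- (1 / a)))"
      using \<open>\<epsilon> > 0\<close> by (simp add: T_def)
    also have "\<dots> = infdist (b \<bullet> y) \<int>"
      using \<open>X > 0\<close> by (simp flip: powr_add)
    finally show ?thesis
      using mult_left_mono[OF *, of T] \<open>T > 0\<close> by (metis less_imp_le max.coboundedI1)
  next
    assume "infdist (b \<bullet> y) \<int> * X \<le> infnorm y"
    then have "infdist (b \<bullet> y) \<int> \<le> infnorm y / X" using \<open>X > 0\<close> by (simp add: field_simps)
    then show ?thesis by simp
  qed
  from inhomogeneous_transference[OF \<open>X > 0\<close> \<open>T > 0\<close> this]
  obtain q where q: "q \<in> int_vecs" "infnorm q \<le> C * T" "dist_int_vecs (A *v q - b) \<le> C / X"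
    unfolding C_def by blast
  show False
  proof (cases "infnorm q \<le> R")
    case True
    then have "\<mu> \<le> C / X" using \<mu>(2)[OF q(1)] q(3) by linarith
    then show False using X \<mu>(1) \<open>C > 0\<close> \<open>X > 0\<close> by (simp add: field_simps)
  next
    case False
    then have "E < infnorm q powr a * dist_int_vecs (A *v q - b)" using q(1) by (intro R) auto
    also have "\<dots> \<le> (C * T) powr a * (C / X)"
      using q \<open>a > 0\<close> by (intro mult_mono powr_mono2) (auto simp: infnorm_pos_le dist_int_vecs_nonneg)
    also have "(C * T) powr a = (C / \<epsilon>) powr a * (X powr (1 / a)) powr a"
      using \<open>C > 0\<close> \<open>\<epsilon> > 0\<close> \<open>X > 0\<close> by (simp add: T_def flip: powr_mult)
    also have "(X powr (1 / a)) powr a = X" using \<open>a > 0\<close> \<open>X > 0\<close> by (simp add: powr_powr)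
    also have "(C / \<epsilon>) powr a * X * (C / X) = E" using \<open>X > 0\<close> by (simp add: E_def)
    finally show False by simp
  qed
qed

lemma infinitely_badly_approximable_if_singular_for:
  fixes A :: "real^'n^'m" and b :: "real^'m"
  assumes sing: "singular_for b (transpose A)"
  shows "infinitely_badly_approximable A b"
  unfolding infinitely_badly_approximable_iff
proof (intro allI impI)
  define a where "a = real CARD('n) / real CARD('m)"
  have "a > 0" by (simp add: a_def)
  have inv_a: "real CARD('m) / real CARD('n) = 1 / a" by (simp add: a_def)
  define m n where "m = real CARD('m)" and "n = real CARD('n)"
  have "m > 0" "n > 0" by (auto simp: m_def n_def)
  fix E :: real assume "E > 0"
  \<comment> \<open>With \<open>X = Q powr a / c\<close> below, \<open>m * D * X\<close> becomes
    \<open>Q powr a * D / (2 * E)\<close>, so the claim reads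
    \<open>1 / 2 < m * D * X\<close>.\<close>
  define c where "c = 2 * m * E"
  have "c > 0" using \<open>m > 0\<close> \<open>E > 0\<close> by (simp add: c_def)
  \<comment> \<open>Chosen to make \<open>\<epsilon> * X powr (- (1 / a))\<close> equal to
    \<open>1 / (2 * n * Q)\<close>.\<close>
  define \<epsilon> where "\<epsilon> = c powr (- (1 / a)) / (2 * n)"
  have "\<epsilon> > 0" using \<open>c > 0\<close> \<open>n > 0\<close> by (simp add: \<epsilon>_def)
  then obtain X0 where X0: "\<And>X. X \<ge> X0 \<Longrightarrow> \<exists>y\<in>int_vecs.
      dist_int_vecs (transpose A *v y) < \<epsilon> * infdist (b \<bullet> y) \<int> * X powr (- (1 / a))
         \<and> infnorm y < infdist (b \<bullet> y) \<int> * X"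
    using sing unfolding singular_for_def eventually_at_top_linorder inv_a by blast
  show "\<exists>R. \<forall>q\<in>int_vecs. R \<le> infnorm q \<longrightarrow>
      E < infnorm q powr (real CARD('n) / real CARD('m)) * dist_int_vecs (A *v q - b)"
    unfolding a_def[symmetric]
  proof (intro exI ballI impI)
    fix q :: "real^'n"
    \<comment> \<open>The second entry of the maximum is the size of \<open>q\<close> at which
      \<open>X\<close> reaches \<open>max 1 X0\<close>.\<close>
    assume q: "q \<in> int_vecs" "max 1 ((c * max 1 X0) powr (1 / a)) \<le> infnorm q"
    define Q where "Q = infnorm q"
    have "Q > 0" using q by (simp add: Q_def)
    define X where "X = Q powr a / c"
    have "X > 0" using \<open>Q > 0\<close> \<open>c > 0\<close> by (simp add: X_def)
    have "c * max 1 X0 = ((c * max 1 X0) powr (1 / a)) powr a"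
      using \<open>a > 0\<close> \<open>c > 0\<close> by (simp add: powr_powr)
    also have "\<dots> \<le> Q powr a" using q(2) \<open>a > 0\<close> by (intro powr_mono2) (auto simp: Q_def)
    finally have "max 1 X0 \<le> X"
      using \<open>c > 0\<close> by (simp only: X_def le_divide_eq mult.commute) simp
    then have "X0 \<le> X" by simp
    then obtain y where y: "y \<in> int_vecs"
      "dist_int_vecs (transpose A *v y) < \<epsilon> * infdist (b \<bullet> y) \<int> * X powr (- (1 / a))"
      "infnorm y < infdist (b \<bullet> y) \<int> * X"
      using X0 by blast
    define \<beta> where "\<beta> = infdist (b \<bullet> y) \<int>"
    have "\<beta> > 0"
      unfolding \<beta>_def using y(3) infnorm_pos_le[of y] \<open>X > 0\<close>
      by (meson le_less_trans zero_less_mult_pos2)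
    define D where "D = dist_int_vecs (A *v q - b)"
    have "D \<ge> 0" by (simp add: D_def dist_int_vecs_nonneg)
    have "X powr (- (1 / a)) = (Q powr a) powr (- (1 / a)) / c powr (- (1 / a))"
      using \<open>Q > 0\<close> \<open>c > 0\<close> by (simp add: X_def powr_divide)
    also have "(Q powr a) powr (- (1 / a)) = 1 / Q"
      using \<open>Q > 0\<close> \<open>a > 0\<close> by (simp add: powr_powr powr_minus_divide)
    finally have "\<epsilon> * X powr (- (1 / a)) = 1 / (2 * n * Q)"
      using \<open>c > 0\<close> by (simp add: \<epsilon>_def)
    then have "\<epsilon> * \<beta> * X powr (- (1 / a)) = \<beta> / (2 * n * Q)"
      by (metis mult.assoc mult.commute mult.right_neutral times_divide_eq_right)
    then have "dist_int_vecs (transpose A *v y) < \<beta> / (2 * n * Q)"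
      using y(2) by (simp only: \<beta>_def)
    \<comment> \<open>The term with the transpose supplies less than half of \<open>\<beta>\<close>,
      so the term with \<open>D\<close> must supply more than the other half.\<close>
    then have "n * dist_int_vecs (transpose A *v y) * Q < \<beta> / 2"
      using \<open>n > 0\<close> \<open>Q > 0\<close> by (simp add: field_simps)
    moreover have "\<beta> \<le> m * D * infnorm y + n * dist_int_vecs (transpose A *v y) * Q"
      using infdist_inner_Ints_le[OF q(1) y(1), of b A] by (simp add: \<beta>_def D_def Q_def m_def n_def)
    moreover have "m * D * infnorm y \<le> m * D * (\<beta> * X)"
      using y(3) \<open>m > 0\<close> \<open>D \<ge> 0\<close> by (intro mult_left_mono) (auto simp: \<beta>_def)
    ultimately have "\<beta> * (1 / 2) < \<beta> * (m * D * X)" by (simp add: algebra_simps)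
    then have "1 / 2 < m * D * X" using \<open>\<beta> > 0\<close> by (metis mult_less_cancel_left_pos)
    then show "E < infnorm q powr a * dist_int_vecs (A *v q - b)"
      using \<open>m > 0\<close> \<open>E > 0\<close> by (simp add: X_def c_def D_def Q_def field_simps)
  qed
qed

theorem theorem1p1:
  shows "(\<forall>(A :: real^'n^'m) (b :: real^'m).
            infinitely_badly_approximable A b \<longleftrightarrow> singular_for b (transpose A))
       \<and> (\<forall>b :: real^'m. (Bad_fiber_infinity b :: (real^'n^'m) set) = Sing b)
       \<and> (Bad_infinity :: ((real^'n^'m) \<times> (real^'m)) set) = (\<Union>b. Sing b \<times> {b})"
proof -
  have iff: "infinitely_badly_approximable A b \<longleftrightarrow> singular_for b (transpose A)"
    for A :: "real^'n^'m" and b :: "real^'m"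
    using singular_for_if_infinitely_badly_approximable infinitely_badly_approximable_if_singular_for
    by blast
  have "(Bad_fiber_infinity b :: (real^'n^'m) set) = Sing b" for b :: "real^'m"
    by (auto simp: Bad_fiber_infinity_def Bad_fiber_def Bad_def Sing_def
        infinitely_badly_approximable_def simp flip: iff)
  moreover have "(Bad_infinity :: ((real^'n^'m) \<times> (real^'m)) set) = (\<Union>b. Sing b \<times> {b})"
    by (auto simp: Bad_infinity_def Bad_def Sing_def
        infinitely_badly_approximable_def simp flip: iff)
  ultimately show ?thesis using iff by blast
qed

end
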